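(* Let $G=([n],E)$ be a 1-walk-regular graph, let $G(\mathbf p)\subseteq\mathbb R^d$ be its least eigenvalue framework and $P\in\mathbb R^{n\times d}$ the corresponding framework matrix. A vector coloring $\mathbf q=(q_1,\dots,q_n)$ of $G$ is optimal if and only if $$\mathrm{Gram}(q_1,\dots,q_n)=\frac nd\left(PP^T+PRP^T\right)$$ for some symmetric $R\in\mathcal S^d$ satisfying $p_i^TRp_j=0$ for all $i\simeq j$.
   Context: A graph with adjacency matrix $A$ is 1-walk-regular if for every $k\in\mathbb N$ there exist $a_k,b_k$ with $A^k\circ I=a_kI$ and $A^k\circ A=b_kA$ ($\circ$ the entrywise product). The least eigenvalue framework of $G$ is given by taking $p_i^T$ to be the $i$-th row of a real $n\times d$ matrix $P$ (the framework matrix) whose columns form an orthonormal basis of the eigenspace of $A$ for its least eigenvalue, $d$ being the multiplicity of that eigenvalue. $\mathrm{Gram}(q_1,\dots,q_n)$ is the matrix with entries $q_i^Tq_j$. For $t\ge2$, a vector $t$-coloring of $G$ is an assignment of real unit vectors $q_i$ with $q_i^Tq_j\le-1/(t-1)$ for all edges $ij$; the vector chromatic number $\chi_v(G)$ is the least $t$ for which one exists, and a vector coloring is optimal if it is a vector $\chi_v(G)$-coloring. $i\simeq j$ means $i=j$ or $i\sim j$; $\mathcal S^d$ is the set of real symmetric $d\times d$ matrices. *)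

theory Defs
  imports
    Complex_Main
    "Graph_Theory.Pair_Digraph"
    "Jordan_Normal_Form.Char_Poly"
    "Jordan_Normal_Form.VS_Connect"
begin

text \<open>
  Throughout, a finite simple graph \<open>G\<close> on \<open>[n]\<close> is a \<^locale>\<open>pair_graph\<close> (finite, symmetric,
  loopless) with vertex set \<open>{0..<n}\<close>, so that vertices double as matrix indices. The edge
  \<open>ij\<close> appears in \<^const>\<open>parcs\<close> as both \<open>(i,j)\<close> and \<open>(j,i)\<close>.
\<close>

definition adj_mat :: "nat \<Rightarrow> nat pair_pre_digraph \<Rightarrow> real mat" where
  "adj_mat n G = mat n n (\<lambda>(i, j). if (i, j) \<in> parcs G then 1 else 0)"

definition entrywise_prod :: "real mat \<Rightarrow> real mat \<Rightarrow> real mat" (infixl \<open>\<odot>\<close> 70) where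
  "M \<odot> N = mat (dim_row M) (dim_col M) (\<lambda>ij. M $$ ij * N $$ ij)"

definition one_walk_regular :: "nat \<Rightarrow> nat pair_pre_digraph \<Rightarrow> bool" where
  "one_walk_regular n G \<longleftrightarrow>
     (\<forall>k::nat. \<exists>a b::real.
        (adj_mat n G ^\<^sub>m k) \<odot> 1\<^sub>m n = a \<cdot>\<^sub>m 1\<^sub>m n \<and>
        (adj_mat n G ^\<^sub>m k) \<odot> adj_mat n G = b \<cdot>\<^sub>m adj_mat n G)"

definition is_least_eigenvalue :: "real mat \<Rightarrow> real \<Rightarrow> bool" where
  "is_least_eigenvalue M \<tau> \<longleftrightarrow> eigenvalue M \<tau> \<and> (\<forall>\<mu>. eigenvalue M \<mu> \<longrightarrow> \<tau> \<le> \<mu>)"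

definition eigenspace :: "real mat \<Rightarrow> real \<Rightarrow> real vec set" where
  "eigenspace M \<tau> = {v \<in> carrier_vec (dim_row M). M *\<^sub>v v = \<tau> \<cdot>\<^sub>v v}"

text \<open>
  The columns of \<open>P\<close> form an orthonormal basis of the eigenspace of the least eigenvalue;
  this forces \<open>d\<close> to be the multiplicity of that eigenvalue.
\<close>
definition least_eigenvalue_framework_matrix ::
    "nat \<Rightarrow> nat pair_pre_digraph \<Rightarrow> nat \<Rightarrow> real mat \<Rightarrow> bool" where
  "least_eigenvalue_framework_matrix n G d P \<longleftrightarrow>
     P \<in> carrier_mat n d \<and>
     (\<exists>\<tau>. is_least_eigenvalue (adj_mat n G) \<tau> \<and>
        (\<forall>j<d. \<forall>l<d. col P j \<bullet> col P l = (if j = l then 1 else 0)) \<and>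
        vec_space.col_space n P = eigenspace (adj_mat n G) \<tau>)"

definition gram_mat :: "nat \<Rightarrow> (nat \<Rightarrow> real vec) \<Rightarrow> real mat" where
  "gram_mat n q = mat n n (\<lambda>(i, j). q i \<bullet> q j)"

text \<open>The dimension \<open>m\<close> of the space containing the unit vectors is arbitrary.\<close>
definition vector_t_coloring :: "nat \<Rightarrow> nat pair_pre_digraph \<Rightarrow> real \<Rightarrow> (nat \<Rightarrow> real vec) \<Rightarrow> bool" where
  "vector_t_coloring n G t q \<longleftrightarrow>
     t \<ge> 2 \<and>
     (\<exists>m. \<forall>i<n. q i \<in> carrier_vec m) \<and>
     (\<forall>i<n. sqrt (q i \<bullet> q i) = 1) \<and>
     (\<forall>(i, j)\<in>parcs G. q i \<bullet> q j \<le> - 1 / (t - 1))"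

definition vector_coloring :: "nat \<Rightarrow> nat pair_pre_digraph \<Rightarrow> (nat \<Rightarrow> real vec) \<Rightarrow> bool" where
  "vector_coloring n G q \<longleftrightarrow> (\<exists>t. vector_t_coloring n G t q)"

definition vector_chromatic_number :: "nat \<Rightarrow> nat pair_pre_digraph \<Rightarrow> real" where
  "vector_chromatic_number n G = (LEAST t. \<exists>q. vector_t_coloring n G t q)"

definition optimal_vector_coloring :: "nat \<Rightarrow> nat pair_pre_digraph \<Rightarrow> (nat \<Rightarrow> real vec) \<Rightarrow> bool" where
  "optimal_vector_coloring n G q \<longleftrightarrow> vector_t_coloring n G (vector_chromatic_number n G) q"

end

theory Submission
  imports Defs
begin

text \<open>
  Let \<open>e\<close> be the number of arcs, \<open>K = PP\<^sup>T\<close> and \<open>B = A - \<tau>I\<close>, which is positive semidefinite. The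
  projection \<open>K\<close> onto \<open>ker B\<close> is a polynomial in \<open>A\<close>, so 1-walk-regularity and traces give
  \<open>K\<^sub>i\<^sub>i = d/n\<close> and \<open>K\<^sub>i\<^sub>j = \<tau>d/e\<close> on arcs. For a vector coloring with Gram matrix \<open>M\<close>,
  \<open>tr(MB) \<ge> 0\<close> says that the inner products over the arcs average at least \<open>\<tau>n/e\<close>, and \<open>(n/d)K\<close>
  attains this bound; hence \<open>q\<close> is optimal iff \<open>M\<^sub>i\<^sub>j = \<tau>n/e\<close> on all arcs. In that case \<open>tr(MB) = 0\<close>,
  which forces \<open>KMK = M\<close>, and \<open>R = (d/n) P\<^sup>TMP - I\<close> is the required matrix.
\<close>

section \<open>Quadratic forms and positive semidefinite matrices\<close>

definition pos_semidef :: "real mat \<Rightarrow> bool" where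
  "pos_semidef M \<longleftrightarrow> (\<forall>x \<in> carrier_vec (dim_row M). x \<bullet> (M *\<^sub>v x) \<ge> 0)"

lemma symmetric_form:
  fixes M :: "real mat"
  assumes "M \<in> carrier_mat n n" "transpose_mat M = M" "x \<in> carrier_vec n" "y \<in> carrier_vec n"
  shows "x \<bullet> (M *\<^sub>v y) = y \<bullet> (M *\<^sub>v x)"
  using transpose_vec_mult_scalar[OF assms(1,4,3)] assms
  by (metis comm_scalar_prod mult_mat_vec_carrier)

lemma scalar_prod_self_eq_0_iff:
  fixes x :: "real vec"
  assumes "x \<in> carrier_vec n"
  shows "x \<bullet> x = 0 \<longleftrightarrow> x = 0\<^sub>v n"
  using conjugate_square_eq_0_vec[OF assms] by simp

lemma quadratic_form_add_smult:
  fixes M :: "real mat"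
  assumes M: "M \<in> carrier_mat n n" and sym: "transpose_mat M = M"
    and x: "x \<in> carrier_vec n" and y: "y \<in> carrier_vec n"
  shows "(x + t \<cdot>\<^sub>v y) \<bullet> (M *\<^sub>v (x + t \<cdot>\<^sub>v y))
    = x \<bullet> (M *\<^sub>v x) + 2 * t * (y \<bullet> (M *\<^sub>v x)) + t\<^sup>2 * (y \<bullet> (M *\<^sub>v y))"
proof -
  have "M *\<^sub>v (x + t \<cdot>\<^sub>v y) = M *\<^sub>v x + t \<cdot>\<^sub>v (M *\<^sub>v y)"
    using M x y by (simp add: mult_add_distrib_mat_vec[of _ n n] mult_mat_vec[of _ n n])
  then show ?thesis
    using M x y symmetric_form[OF M sym x y]
    by (simp add: add_scalar_prod_distrib[of _ n] scalar_prod_add_distrib[of _ n]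
        power2_eq_square algebra_simps)
qed

text \<open>Along the line \<open>x + t y\<close> the form is a polynomial of degree at most two in
  \<open>t\<close> that is never negative, so its discriminant cannot be positive.\<close>

lemma pos_semidef_Cauchy_Schwarz:
  assumes M: "M \<in> carrier_mat n n" and sym: "transpose_mat M = M" and psd: "pos_semidef M"
    and x: "x \<in> carrier_vec n" and y: "y \<in> carrier_vec n"
  shows "(y \<bullet> (M *\<^sub>v x))\<^sup>2 \<le> (y \<bullet> (M *\<^sub>v y)) * (x \<bullet> (M *\<^sub>v x))"
proof -
  define a b c where "a = x \<bullet> (M *\<^sub>v x)" and "b = y \<bullet> (M *\<^sub>v x)" and "c = y \<bullet> (M *\<^sub>v y)"
  have q: "0 \<le> a + 2 * t * b + t\<^sup>2 * c" for t
    using psd quadratic_form_add_smult[OF M sym x y, of t] M x y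
    unfolding pos_semidef_def a_def b_def c_def by (metis add_carrier_vec carrier_matD(1) smult_carrier_vec)
  have a0: "a \<ge> 0" and c0: "c \<ge> 0"
    using psd M x y unfolding pos_semidef_def a_def b_def c_def by auto
  show ?thesis
  proof (cases "c = 0")
    case True
    have "b = 0"
    proof (rule ccontr)
      assume "b \<noteq> 0"
      \<comment> \<open>With \<open>c = 0\<close> the polynomial is linear in \<open>t\<close>; this
        \<open>t\<close> gives it the value -1.\<close>
      with q[of "- (a + 1) / (2 * b)"] True show False by (simp add: field_simps)
    qed
    with a0 c0 show ?thesis by (simp add: a_def b_def c_def)
  next
    case False
    with c0 have "c > 0" by simp
    \<comment> \<open>The minimizer of the quadratic in \<open>t\<close>.\<close>
    with q[of "- b / c"] have "b\<^sup>2 \<le> c * a"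
      by (simp add: field_simps power2_eq_square)
    then show ?thesis by (simp add: a_def b_def c_def)
  qed
qed

text \<open>Cauchy-Schwarz with \<open>y = M x\<close> bounds the square of
  \<open>(M x) \<bullet> (M x)\<close> by a multiple of the vanishing value of the form at
  \<open>x\<close>.\<close>

lemma pos_semidef_form_eq_0D:
  assumes M: "M \<in> carrier_mat n n" and sym: "transpose_mat M = M" and psd: "pos_semidef M"
    and x: "x \<in> carrier_vec n" and 0: "x \<bullet> (M *\<^sub>v x) = 0"
  shows "M *\<^sub>v x = 0\<^sub>v n"
proof -
  have Mx: "M *\<^sub>v x \<in> carrier_vec n" using M x by simp
  show ?thesis
    using pos_semidef_Cauchy_Schwarz[OF M sym psd x Mx] 0 scalar_prod_self_eq_0_iff[OF Mx] by simp
qed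

lemma quadratic_form_bounded:
  fixes M :: "real mat"
  assumes M: "M \<in> carrier_mat n n"
  obtains C where "C > 0" "\<And>x. x \<in> carrier_vec n \<Longrightarrow> \<bar>x \<bullet> (M *\<^sub>v x)\<bar> \<le> C * (x \<bullet> x)"
proof
  \<comment> \<open>The summand 1 keeps the bound positive even for a zero matrix, so that its
    reciprocal can later serve as a positive increment.\<close>
  define C where "C = (\<Sum>i<n. \<Sum>j<n. \<bar>M $$ (i,j)\<bar>) + 1"
  show "C > 0" unfolding C_def by (simp add: add_nonneg_pos sum_nonneg)
  fix x :: "real vec" assume x: "x \<in> carrier_vec n"
  have le: "(x $ i)\<^sup>2 \<le> x \<bullet> x" if "i < n" for i
    using that x member_le_sum[of i "{0..<n}" "\<lambda>i. (x $ i)\<^sup>2"]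
    by (simp add: scalar_prod_def power2_eq_square)
  have nn: "x \<bullet> x \<ge> 0" by (simp add: scalar_prod_def sum_nonneg)
  have prod: "\<bar>x $ i\<bar> * \<bar>x $ j\<bar> \<le> x \<bullet> x" if "i < n" "j < n" for i j
    using le[OF that(1)] le[OF that(2)] sum_squares_bound[of "\<bar>x $ i\<bar>" "\<bar>x $ j\<bar>"] by simp
  have "x \<bullet> (M *\<^sub>v x) = (\<Sum>i<n. \<Sum>j<n. M $$ (i,j) * (x $ i * x $ j))"
    using M x by (simp add: scalar_prod_def sum_distrib_left lessThan_atLeast0 mult_ac)
  also have "\<bar>\<dots>\<bar> \<le> (\<Sum>i<n. \<Sum>j<n. \<bar>M $$ (i,j)\<bar> * (x \<bullet> x))"
    by (intro order.trans[OF sum_abs] sum_mono)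
      (auto simp: abs_mult intro!: mult_left_mono prod)
  also have "\<dots> = (\<Sum>i<n. \<Sum>j<n. \<bar>M $$ (i,j)\<bar>) * (x \<bullet> x)"
    by (simp add: sum_distrib_right)
  also have "\<dots> \<le> C * (x \<bullet> x)"
    using nn unfolding C_def by (simp add: algebra_simps)
  finally show "\<bar>x \<bullet> (M *\<^sub>v x)\<bar> \<le> C * (x \<bullet> x)" .
qed

section \<open>Shifts by multiples of the identity and the least eigenvalue\<close>

lemma smult_mat_mult_vec:
  fixes M :: "real mat"
  assumes "M \<in> carrier_mat n m" "x \<in> carrier_vec m"
  shows "(c \<cdot>\<^sub>m M) *\<^sub>v x = c \<cdot>\<^sub>v (M *\<^sub>v x)"
  using assms by (intro eq_vecI) auto

lemma mult_minus_smult_one_vec: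
  fixes A :: "real mat"
  assumes "A \<in> carrier_mat n n" "x \<in> carrier_vec n"
  shows "(A - m \<cdot>\<^sub>m 1\<^sub>m n) *\<^sub>v x = A *\<^sub>v x - m \<cdot>\<^sub>v x"
  using assms by (auto simp: minus_mult_distrib_mat_vec[of _ n n])

lemma form_minus_smult_one:
  fixes A :: "real mat"
  assumes "A \<in> carrier_mat n n" "x \<in> carrier_vec n" "y \<in> carrier_vec n"
  shows "y \<bullet> ((A - m \<cdot>\<^sub>m 1\<^sub>m n) *\<^sub>v x) = y \<bullet> (A *\<^sub>v x) - m * (y \<bullet> x)"
  using assms by (simp add: mult_minus_smult_one_vec scalar_prod_minus_distrib[of _ n])

lemma inverse_mat_exists:
  fixes M :: "real mat"
  assumes M: "M \<in> carrier_mat n n" and inj: "\<And>v. v \<in> carrier_vec n \<Longrightarrow> M *\<^sub>v v = 0\<^sub>v n \<Longrightarrow> v = 0\<^sub>v n"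
  obtains N where "N \<in> carrier_mat n n" "M * N = 1\<^sub>m n"
proof -
  have "det M \<noteq> 0" using inj unfolding det_0_iff_vec_prod_zero[OF M] by blast
  from det_non_zero_imp_unit[OF M this, of "()"] show ?thesis
    using that unfolding Units_def ring_mat_def by auto
qed

lemma symmetric_minus_smult_one:
  fixes A :: "real mat"
  assumes "A \<in> carrier_mat n n" "transpose_mat A = A"
  shows "transpose_mat (A - m \<cdot>\<^sub>m 1\<^sub>m n) = A - m \<cdot>\<^sub>m 1\<^sub>m n"
proof -
  have sym: "A $$ (j, i) = A $$ (i, j)" if "i < n" "j < n" for i j
    using assms that by (metis index_transpose_mat(1) carrier_matD)
  show ?thesis using assms(1) by (intro eq_matI) (auto simp: sym)
qed

lemma kernel_minus_smult_one_iff: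
  fixes A :: "real mat"
  assumes A: "A \<in> carrier_mat n n" and v: "v \<in> carrier_vec n"
  shows "(A - m \<cdot>\<^sub>m 1\<^sub>m n) *\<^sub>v v = 0\<^sub>v n \<longleftrightarrow> A *\<^sub>v v = m \<cdot>\<^sub>v v"
proof -
  have "(A *\<^sub>v v - m \<cdot>\<^sub>v v = 0\<^sub>v n) \<longleftrightarrow> A *\<^sub>v v = m \<cdot>\<^sub>v v"
    using A v by (auto simp: vec_eq_iff)
  then show ?thesis by (simp add: mult_minus_smult_one_vec[OF A v])
qed

text \<open>A Rayleigh quotient argument that needs no diagonalization. Let \<open>\<mu>\<close> be
  the largest \<open>m\<close> with \<open>m (x \<bullet> x) \<le> x \<bullet> A x\<close> for all
  \<open>x\<close>. If \<open>A - \<mu> I\<close> were injective, its inverse would allow a larger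
  \<open>m\<close>; hence \<open>\<mu>\<close> is an eigenvalue and
  \<open>\<tau> \<le> \<mu>\<close>. An eigenvector for \<open>\<tau>\<close> gives
  \<open>\<mu> \<le> \<tau>\<close>.\<close>

lemma least_eigenvalue_pos_semidef:
  assumes A: "A \<in> carrier_mat n n" and sym: "transpose_mat A = A"
    and least: "is_least_eigenvalue A \<tau>"
  shows "pos_semidef (A - \<tau> \<cdot>\<^sub>m 1\<^sub>m n)"
proof -
  define T where "T = {m. \<forall>x \<in> carrier_vec n. m * (x \<bullet> x) \<le> x \<bullet> (A *\<^sub>v x)}"
  have nn: "x \<bullet> x \<ge> 0" for x :: "real vec" by (simp add: scalar_prod_def sum_nonneg)
  obtain C where C: "\<And>x. x \<in> carrier_vec n \<Longrightarrow> \<bar>x \<bullet> (A *\<^sub>v x)\<bar> \<le> C * (x \<bullet> x)"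
    using quadratic_form_bounded[OF A] by blast
  have "- C \<in> T" unfolding T_def using C by (fastforce simp: abs_le_iff)
  obtain v where v: "v \<in> carrier_vec n" "v \<noteq> 0\<^sub>v n" "A *\<^sub>v v = \<tau> \<cdot>\<^sub>v v"
    using least A unfolding is_least_eigenvalue_def eigenvalue_def eigenvector_def by auto
  have vv: "v \<bullet> v > 0" using nn[of v] scalar_prod_self_eq_0_iff[OF v(1)] v(2) by simp
  \<comment> \<open>The inequality defining \<open>T\<close>, tested on the eigenvector
    \<open>v\<close>.\<close>
  have le_tau: "m \<le> \<tau>" if "m \<in> T" for m
    using that v vv unfolding T_def by auto
  then have bdd: "bdd_above T" by (auto simp: bdd_above_def)
  define \<mu> where "\<mu> = Sup T"
  have "\<mu> * (x \<bullet> x) \<le> x \<bullet> (A *\<^sub>v x)" if x: "x \<in> carrier_vec n" for x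
  proof (cases "x \<bullet> x = 0")
    case True
    then show ?thesis using C[OF x] by simp
  next
    case False
    then have pos: "x \<bullet> x > 0" using nn[of x] by simp
    have "\<mu> \<le> (x \<bullet> (A *\<^sub>v x)) / (x \<bullet> x)"
      unfolding \<mu>_def
    proof (rule cSup_least)
      show "T \<noteq> {}" using \<open>- C \<in> T\<close> by blast
    qed (use x pos in \<open>auto simp: T_def pos_le_divide_eq\<close>)
    then show ?thesis using pos by (simp add: pos_le_divide_eq)
  qed
  note mu = this
  let ?M = "A - \<mu> \<cdot>\<^sub>m 1\<^sub>m n"
  have M: "?M \<in> carrier_mat n n" using A by (simp add: minus_carrier_mat)
  have Msym: "transpose_mat ?M = ?M" by (rule symmetric_minus_smult_one[OF A sym])
  have psd: "pos_semidef ?M"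
    unfolding pos_semidef_def using mu A by (simp add: form_minus_smult_one[OF A])
  have "eigenvalue A \<mu>"
  proof (rule ccontr)
    assume not_ev: "\<not> eigenvalue A \<mu>"
    have inj: "x = 0\<^sub>v n" if x: "x \<in> carrier_vec n" and 0: "?M *\<^sub>v x = 0\<^sub>v n" for x
      using not_ev x 0 A unfolding kernel_minus_smult_one_iff[OF A x] eigenvalue_def eigenvector_def
      by auto
    then obtain N where N: "N \<in> carrier_mat n n" "?M * N = 1\<^sub>m n"
      using inverse_mat_exists[OF M] by blast
    obtain D where D: "D > 0" "\<And>x. x \<in> carrier_vec n \<Longrightarrow> \<bar>x \<bullet> (N *\<^sub>v x)\<bar> \<le> D * (x \<bullet> x)"
      using quadratic_form_bounded[OF N(1)] by blast
    (* Cauchy-Schwarz for the form M, applied to x and its preimage under M, bounds the form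
       away from 0, so mu could be increased. *)
    have "\<mu> + 1 / D \<in> T"
      unfolding T_def
    proof (intro CollectI ballI)
      fix x :: "real vec" assume x: "x \<in> carrier_vec n"
      have Nx: "N *\<^sub>v x \<in> carrier_vec n" using N x by simp
      have MNx: "?M *\<^sub>v (N *\<^sub>v x) = x"
        using N x M by (metis assoc_mult_mat_vec one_mult_mat_vec)
      define s f where "s = x \<bullet> x" and "f = x \<bullet> (?M *\<^sub>v x)"
      have f0: "f \<ge> 0" using psd x A unfolding pos_semidef_def f_def by simp
      have "((N *\<^sub>v x) \<bullet> (?M *\<^sub>v x)) = s"
        using symmetric_form[OF M Msym Nx x] unfolding s_def MNx .
      moreover have "(N *\<^sub>v x) \<bullet> (?M *\<^sub>v (N *\<^sub>v x)) \<le> D * s"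
        unfolding MNx using D(2)[OF x] comm_scalar_prod[OF x Nx] by (simp add: s_def)
      ultimately have "s\<^sup>2 \<le> (D * s) * f"
        using pos_semidef_Cauchy_Schwarz[OF M Msym psd x Nx] f0
        unfolding f_def by (metis mult_right_mono order.trans)
      then have "s * s \<le> s * (D * f)" by (simp add: power2_eq_square mult_ac)
      then have "s \<le> D * f"
        using nn[of x] f0 D(1) unfolding s_def[symmetric]
        by (cases "s = 0") (auto simp: mult_le_cancel_left)
      then have "s / D \<le> f" using D(1) by (simp add: pos_divide_le_eq mult.commute)
      then show "(\<mu> + 1 / D) * (x \<bullet> x) \<le> x \<bullet> (A *\<^sub>v x)"
        unfolding f_def form_minus_smult_one[OF A x x] s_def by (simp add: algebra_simps)
    qed
    then have "\<mu> + 1 / D \<le> \<mu>" unfolding \<mu>_def using bdd by (rule cSup_upper)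
    with D(1) show False by simp
  qed
  then have "\<tau> \<le> \<mu>" using least unfolding is_least_eigenvalue_def by blast
  moreover have "\<mu> \<le> \<tau>" unfolding \<mu>_def using \<open>- C \<in> T\<close> le_tau by (intro cSup_least) auto
  ultimately show ?thesis using psd by simp
qed

section \<open>Matrix powers and the kernel projection as a polynomial\<close>

lemma pow_mat_add:
  fixes A :: "'a :: semiring_1 mat"
  assumes "A \<in> carrier_mat n n"
  shows "A ^\<^sub>m (j + k) = A ^\<^sub>m j * A ^\<^sub>m k"
proof (induction k)
  case 0
  show ?case using assms pow_carrier_mat[OF assms, of j] by simp
next
  case (Suc k)
  then show ?case using assms by (simp add: assoc_mult_mat[of _ n n _ n _ n])
qed

lemma pow_mat_Suc_left:
  fixes A :: "'a :: semiring_1 mat"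
  assumes "A \<in> carrier_mat n n"
  shows "A ^\<^sub>m Suc k = A * A ^\<^sub>m k"
  using pow_mat_add[OF assms, of 1 k] assms by simp

lemma transpose_pow_mat:
  fixes A :: "'a :: comm_semiring_1 mat"
  assumes A: "A \<in> carrier_mat n n" and sym: "transpose_mat A = A"
  shows "transpose_mat (A ^\<^sub>m k) = A ^\<^sub>m k"
proof (induction k)
  case (Suc k)
  have "transpose_mat (A ^\<^sub>m k * A) = transpose_mat A * transpose_mat (A ^\<^sub>m k)"
    using A by (intro transpose_mult) auto
  then show ?case using Suc sym pow_mat_Suc_left[OF A, of k] by simp
qed simp

text \<open>The \<open>n * n + 1\<close> powers lie in a space of dimension \<open>n * n\<close>.
  Writing them as columns of a square matrix with one spare row turns dependence into a vanishing
  determinant.\<close>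

lemma powers_linearly_dependent:
  fixes B :: "real mat"
  assumes B: "B \<in> carrier_mat n n"
  shows "\<exists>c. (\<exists>k\<le>n * n. c k \<noteq> 0) \<and>
    (\<forall>i<n. \<forall>j<n. (\<Sum>k\<le>n * n. c k * (B ^\<^sub>m k) $$ (i, j)) = 0)"
proof -
  define N where "N = n * n"
  (* The k-th column lists the entries of the k-th power; the last row is zero. *)
  define M where "M = mat (Suc N) (Suc N)
    (\<lambda>(r, k). if r < N then (B ^\<^sub>m k) $$ (r div n, r mod n) else 0)"
  have M: "M \<in> carrier_mat (Suc N) (Suc N)" by (simp add: M_def)
  \<comment> \<open>The spare row \<open>N\<close> is zero, so the last unit vector is in the kernel
    of the transpose and \<open>det M = 0\<close>. A nonzero kernel vector of \<open>M\<close>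
    itself then supplies the coefficients.\<close>
  have "transpose_mat M *\<^sub>v unit_vec (Suc N) N = 0\<^sub>v (Suc N)"
    by (rule eq_vecI) (auto simp: M_def)
  moreover have "unit_vec (Suc N) N \<noteq> (0\<^sub>v (Suc N) :: real vec)" by simp
  ultimately have "det (transpose_mat M) = 0"
    using det_0_iff_vec_prod_zero[of "transpose_mat M" "Suc N"] M by (metis transpose_carrier_mat unit_vec_carrier)
  then have "det M = 0" by (simp add: det_transpose[OF M])
  then obtain v where v: "v \<in> carrier_vec (Suc N)" "v \<noteq> 0\<^sub>v (Suc N)" "M *\<^sub>v v = 0\<^sub>v (Suc N)"
    using det_0_iff_vec_prod_zero[OF M] by blast
  obtain k where k: "k < Suc N" "v $ k \<noteq> 0" using v(1,2) by (auto simp: vec_eq_iff)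
  show ?thesis
  proof (intro exI[of _ "\<lambda>k. v $ k"] conjI allI impI)
    show "\<exists>k\<le>n * n. v $ k \<noteq> 0" using k by (auto simp: N_def less_Suc_eq_le)
    fix i j assume ij: "i < n" "j < n"
    \<comment> \<open>Row-major position of the entry \<open>(i, j)\<close>, inverted by
      \<open>div\<close> and \<open>mod\<close>.\<close>
    define r where "r = i * n + j"
    have "Suc i * n \<le> n * n" using ij(1) by (intro mult_right_mono) auto
    then have r: "r < N" "r div n = i" "r mod n = j" using ij by (auto simp: r_def N_def)
    have "(M *\<^sub>v v) $ r = 0" using v(3) r by simp
    moreover have "(M *\<^sub>v v) $ r = (\<Sum>k\<in>{0..<Suc N}. (B ^\<^sub>m k) $$ (i, j) * v $ k)"
      using r v(1) by (simp add: M_def scalar_prod_def)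
    ultimately show "(\<Sum>k\<le>n * n. v $ k * (B ^\<^sub>m k) $$ (i, j)) = 0"
      by (simp add: N_def mult.commute atLeast0LessThan lessThan_Suc_atMost)
  qed
qed

text \<open>By symmetry the squared length of \<open>B w\<close> is
  \<open>w \<bullet> B (B w)\<close>, so \<open>B (B w) = 0\<close> already forces
  \<open>B w = 0\<close>. The induction strips one factor at a time.\<close>

lemma symmetric_kernel_pow:
  fixes B :: "real mat"
  assumes B: "B \<in> carrier_mat n n" and sym: "transpose_mat B = B"
    and "w \<in> carrier_vec n" "B ^\<^sub>m j *\<^sub>v w = 0\<^sub>v n"
  shows "B *\<^sub>v w = 0\<^sub>v n"
  using assms(3,4)
proof (induction j arbitrary: w)
  case 0
  then show ?case using B by auto
next
  case (Suc j)
  have Bw: "B *\<^sub>v w \<in> carrier_vec n" using B Suc.prems by simp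
  have "B ^\<^sub>m j *\<^sub>v (B *\<^sub>v w) = 0\<^sub>v n"
    using Suc.prems B by (simp add: assoc_mult_mat_vec[of _ n n _ n])
  then have "B *\<^sub>v (B *\<^sub>v w) = 0\<^sub>v n" using Suc.IH Bw by blast
  then have "(B *\<^sub>v w) \<bullet> (B *\<^sub>v w) = 0"
    using symmetric_form[OF B sym Bw Suc.prems(1)] Suc.prems(1) by simp
  then show ?case using scalar_prod_self_eq_0_iff[OF Bw] by simp
qed

text \<open>Summation is entrywise with the dimension as a parameter, so that an empty index set
  also yields an \<open>n\<close> by \<open>n\<close> matrix.\<close>

definition mat_lincomb :: "nat \<Rightarrow> nat set \<Rightarrow> (nat \<Rightarrow> real) \<Rightarrow> (nat \<Rightarrow> real mat) \<Rightarrow> real mat" where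
  "mat_lincomb n K h M = mat n n (\<lambda>ij. \<Sum>k\<in>K. h k * M k $$ ij)"

lemma mat_lincomb_carrier [simp]: "mat_lincomb n K h M \<in> carrier_mat n n"
  by (simp add: mat_lincomb_def)

lemma mult_mat_lincomb:
  assumes "B \<in> carrier_mat n n" "\<And>k. k \<in> K \<Longrightarrow> M k \<in> carrier_mat n n"
  shows "B * mat_lincomb n K h M = mat_lincomb n K h (\<lambda>k. B * M k)"
proof (rule eq_matI)
  fix i j assume "i < dim_row (mat_lincomb n K h (\<lambda>k. B * M k))" "j < dim_col (mat_lincomb n K h (\<lambda>k. B * M k))"
  then have ij: "i < n" "j < n" by (auto simp: mat_lincomb_def)
  have "(B * mat_lincomb n K h M) $$ (i, j) = (\<Sum>e\<in>{0..<n}. B $$ (i, e) * (\<Sum>k\<in>K. h k * M k $$ (e, j)))"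
    using ij assms(1) by (simp add: scalar_prod_def mat_lincomb_def)
  also have "\<dots> = (\<Sum>k\<in>K. h k * (\<Sum>e\<in>{0..<n}. B $$ (i, e) * M k $$ (e, j)))"
    unfolding sum_distrib_left by (subst sum.swap) (simp add: mult_ac)
  also have "\<dots> = mat_lincomb n K h (\<lambda>k. B * M k) $$ (i, j)"
    using ij assms by (auto simp: scalar_prod_def mat_lincomb_def carrier_matD[OF assms(2)] intro!: sum.cong)
  finally show "(B * mat_lincomb n K h M) $$ (i, j) = mat_lincomb n K h (\<lambda>k. B * M k) $$ (i, j)" .
qed (use assms in \<open>auto simp: mat_lincomb_def\<close>)

lemma mat_lincomb_mult_vec_index:
  assumes "\<And>k. k \<in> K \<Longrightarrow> M k \<in> carrier_mat n n" "v \<in> carrier_vec n" "i < n"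
  shows "(mat_lincomb n K h M *\<^sub>v v) $ i = (\<Sum>k\<in>K. h k * (M k *\<^sub>v v) $ i)"
proof -
  have "(mat_lincomb n K h M *\<^sub>v v) $ i = (\<Sum>e\<in>{0..<n}. (\<Sum>k\<in>K. h k * M k $$ (i, e)) * v $ e)"
    using assms by (simp add: scalar_prod_def mat_lincomb_def)
  also have "\<dots> = (\<Sum>k\<in>K. h k * (\<Sum>e\<in>{0..<n}. M k $$ (i, e) * v $ e))"
    unfolding sum_distrib_left sum_distrib_right by (subst sum.swap) (simp add: mult_ac)
  also have "\<dots> = (\<Sum>k\<in>K. h k * (M k *\<^sub>v v) $ i)"
    using assms by (auto simp: scalar_prod_def carrier_matD[OF assms(1)] intro!: sum.cong)
  finally show ?thesis .
qed

(* If c_j is the lowest nonzero coefficient of a polynomial annihilating B, then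
   F = sum_k (c_{j+k} / c_j) B^k satisfies B^j F = 0, hence B F = 0 by symmetry. *)
lemma kernel_projection_in_powers:
  fixes B :: "real mat"
  assumes B: "B \<in> carrier_mat n n" and sym: "transpose_mat B = B"
  shows "\<exists>F K h. F = mat_lincomb n K h (\<lambda>k. B ^\<^sub>m k) \<and> finite K \<and>
    (\<forall>v \<in> carrier_vec n. B *\<^sub>v (F *\<^sub>v v) = 0\<^sub>v n) \<and>
    (\<forall>v \<in> carrier_vec n. B *\<^sub>v v = 0\<^sub>v n \<longrightarrow> F *\<^sub>v v = v)"
proof -
  obtain c where ex: "\<exists>k\<le>n * n. c k \<noteq> 0"
    and c: "\<forall>i<n. \<forall>j<n. (\<Sum>k\<le>n * n. c k * (B ^\<^sub>m k) $$ (i, j)) = 0"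
    using powers_linearly_dependent[OF B] by blast
  obtain k where ck: "k \<le> n * n" "c k \<noteq> 0" using ex by blast
  define j where "j = (LEAST k. c k \<noteq> 0)"
  have cj: "c j \<noteq> 0" using ck(2) unfolding j_def by (rule LeastI)
  have "j \<le> k" using ck(2) unfolding j_def by (rule Least_le)
  with ck(1) have jn: "j \<le> n * n" by simp
  have low: "c i = 0" if "i < j" for i using that not_less_Least unfolding j_def by blast
  define K where "K = {..n * n - j}"
  define h where "h = (\<lambda>k. c (j + k) / c j)"
  define F where "F = mat_lincomb n K h (\<lambda>k. B ^\<^sub>m k)"
  have F: "F \<in> carrier_mat n n" by (simp add: F_def)
  have "B ^\<^sub>m j * F = mat_lincomb n K h (\<lambda>k. B ^\<^sub>m (j + k))"
    unfolding F_def pow_mat_add[OF B] using B by (intro mult_mat_lincomb) auto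
  also have "\<dots> = 0\<^sub>m n n"
  proof (rule eq_matI)
    fix a b assume "a < dim_row (0\<^sub>m n n)" "b < dim_col (0\<^sub>m n n)"
    then have ab: "a < n" "b < n" by auto
    \<comment> \<open>Shifting the index by \<open>j\<close> recovers the annihilating polynomial:
      the terms below \<open>j\<close> have coefficient 0 and may be added freely.\<close>
    have "(\<Sum>k\<in>K. c (j + k) * (B ^\<^sub>m (j + k)) $$ (a, b)) = (\<Sum>k\<in>{j..n * n}. c k * (B ^\<^sub>m k) $$ (a, b))"
      by (rule sum.reindex_bij_witness[of _ "\<lambda>k. k - j" "\<lambda>k. j + k"]) (use jn in \<open>auto simp: K_def\<close>)
    also have "\<dots> = (\<Sum>k\<le>n * n. c k * (B ^\<^sub>m k) $$ (a, b))"
      by (rule sum.mono_neutral_left) (auto simp: low)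
    finally have "(\<Sum>k\<in>K. h k * (B ^\<^sub>m (j + k)) $$ (a, b)) = 0"
      using c ab by (simp add: h_def sum_divide_distrib[symmetric])
    then show "mat_lincomb n K h (\<lambda>k. B ^\<^sub>m (j + k)) $$ (a, b) = 0\<^sub>m n n $$ (a, b)"
      using ab by (simp add: mat_lincomb_def)
  qed (auto simp: mat_lincomb_def)
  finally have BjF: "B ^\<^sub>m j * F = 0\<^sub>m n n" .
  show ?thesis
  proof (intro exI[of _ F] exI[of _ K] exI[of _ h] conjI ballI impI)
    fix v :: "real vec" assume v: "v \<in> carrier_vec n"
    have "0\<^sub>m n n *\<^sub>v v = 0\<^sub>v n" using v by (intro eq_vecI) auto
    then have "B ^\<^sub>m j *\<^sub>v (F *\<^sub>v v) = 0\<^sub>v n"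
      using assoc_mult_mat_vec[of "B ^\<^sub>m j" n n F n v] BjF B F v by simp
    then show "B *\<^sub>v (F *\<^sub>v v) = 0\<^sub>v n"
      using symmetric_kernel_pow[OF B sym] F v by (metis mult_mat_vec_carrier)
  next
    fix v :: "real vec" assume v: "v \<in> carrier_vec n" and Bv: "B *\<^sub>v v = 0\<^sub>v n"
    \<comment> \<open>On the kernel all positive powers vanish, so only the term
      \<open>k = 0\<close> of \<open>F\<close> contributes, with coefficient
      \<open>h 0 = c j / c j = 1\<close>.\<close>
    have pow: "B ^\<^sub>m k *\<^sub>v v = (if k = 0 then v else 0\<^sub>v n)" for k
    proof (cases k)
      case (Suc l)
      have "B ^\<^sub>m Suc l *\<^sub>v v = B ^\<^sub>m l *\<^sub>v (B *\<^sub>v v)"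
        using B v by (simp add: assoc_mult_mat_vec[of _ n n _ n])
      moreover have "B ^\<^sub>m l *\<^sub>v 0\<^sub>v n = 0\<^sub>v n"
        using pow_carrier_mat[OF B, of l] by (intro eq_vecI) (auto simp: scalar_prod_def)
      ultimately show ?thesis using Suc Bv by simp
    qed (use B v in auto)
    show "F *\<^sub>v v = v"
    proof (rule eq_vecI)
      fix i assume "i < dim_vec v"
      then have i: "i < n" using v by simp
      have "(F *\<^sub>v v) $ i = (\<Sum>k\<in>K. if k = 0 then h k * v $ i else 0)"
        unfolding F_def using B i v
        by (subst mat_lincomb_mult_vec_index) (auto simp: pow intro!: sum.cong)
      also have "\<dots> = v $ i" by (simp add: K_def h_def cj)
      finally show "(F *\<^sub>v v) $ i = v $ i" .
    qed (use F v in auto)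
  qed (simp_all add: F_def K_def)
qed

section \<open>Traces and Gram matrices\<close>

lemma sum_diag_mult:
  fixes M N :: "'a :: comm_semiring_1 mat"
  assumes "M \<in> carrier_mat n m" "N \<in> carrier_mat m n"
  shows "(\<Sum>i<n. (M * N) $$ (i, i)) = (\<Sum>i<n. \<Sum>j<m. M $$ (i, j) * N $$ (j, i))"
  using assms by (simp add: scalar_prod_def atLeast0LessThan)

lemma gram_mat_eq:
  assumes "\<forall>i<n. q i \<in> carrier_vec m"
  shows "gram_mat n q = mat n m (\<lambda>(i, l). q i $ l) * transpose_mat (mat n m (\<lambda>(i, l). q i $ l))"
proof (rule eq_matI)
  let ?Q = "mat n m (\<lambda>(i, l). q i $ l)"
  fix i j assume "i < dim_row (?Q * transpose_mat ?Q)" "j < dim_col (?Q * transpose_mat ?Q)"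
  then have ij: "i < n" "j < n" by auto
  then show "gram_mat n q $$ (i, j) = (?Q * transpose_mat ?Q) $$ (i, j)"
    using carrier_vecD[OF assms[rule_format, OF ij(2)]] by (simp add: gram_mat_def scalar_prod_def)
qed (auto simp: gram_mat_def)

text \<open>Both sides are the trace of \<open>N Q Q^T\<close>. The right side is a sum of values of
  the form of \<open>N\<close>, to which semidefiniteness applies term by term.\<close>

lemma sum_form_cols:
  fixes N :: "real mat"
  assumes N: "N \<in> carrier_mat n n" and Q: "Q \<in> carrier_mat n m"
  shows "(\<Sum>i<n. \<Sum>j<n. N $$ (i, j) * (Q * transpose_mat Q) $$ (i, j))
    = (\<Sum>l<m. col Q l \<bullet> (N *\<^sub>v col Q l))"
proof -
  have "(\<Sum>l<m. col Q l \<bullet> (N *\<^sub>v col Q l))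
      = (\<Sum>l<m. \<Sum>i<n. \<Sum>j<n. N $$ (i, j) * (Q $$ (i, l) * Q $$ (j, l)))"
    using N Q by (simp add: scalar_prod_def atLeast0LessThan sum_distrib_left mult_ac)
  also have "\<dots> = (\<Sum>i<n. \<Sum>l<m. \<Sum>j<n. N $$ (i, j) * (Q $$ (i, l) * Q $$ (j, l)))"
    by (rule sum.swap)
  also have "\<dots> = (\<Sum>i<n. \<Sum>j<n. \<Sum>l<m. N $$ (i, j) * (Q $$ (i, l) * Q $$ (j, l)))"
    by (rule sum.cong[OF refl], rule sum.swap)
  also have "\<dots> = (\<Sum>i<n. \<Sum>j<n. N $$ (i, j) * (Q * transpose_mat Q) $$ (i, j))"
    using Q by (simp add: scalar_prod_def atLeast0LessThan sum_distrib_left)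
  finally show ?thesis by simp
qed

section \<open>The framework matrix and its projection \<open>P P^T\<close>\<close>

locale least_eigenvalue_framework =
  fixes n d :: nat and G :: "nat pair_pre_digraph" and P :: "real mat" and \<tau> :: real
  assumes graph: "pair_graph G"
    and verts: "pverts G = {0..<n}"
    and regular: "one_walk_regular n G"
    and P: "P \<in> carrier_mat n d"
    and least: "is_least_eigenvalue (adj_mat n G) \<tau>"
    and orthonormal: "\<And>j l. j < d \<Longrightarrow> l < d \<Longrightarrow> col P j \<bullet> col P l = (if j = l then 1 else 0)"
    and col_space: "vec_space.col_space n P = eigenspace (adj_mat n G) \<tau>"
begin

abbreviation "A \<equiv> adj_mat n G"
abbreviation "K \<equiv> P * transpose_mat P"

lemma A [simp]: "A \<in> carrier_mat n n"
  by (simp add: adj_mat_def)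

lemma K [simp]: "K \<in> carrier_mat n n"
  using P by (metis mult_carrier_mat transpose_carrier_mat)

lemma arcD:
  assumes "(i, j) \<in> parcs G"
  shows "i < n" "j < n" "i \<noteq> j" "(j, i) \<in> parcs G"
proof -
  interpret pair_graph G by (rule graph)
  show "i < n" "j < n" using in_arcsD1[OF assms] in_arcsD2[OF assms] verts by auto
  show "i \<noteq> j" using pair_no_loops[OF assms] by simp
  show "(j, i) \<in> parcs G" using assms arcs_symmetric by blast
qed

lemma finite_arcs: "finite (parcs G)"
proof -
  interpret pair_graph G by (rule graph)
  show ?thesis by (rule pair_finite_arcs)
qed

lemma dim_A [simp]: "dim_row A = n" "dim_col A = n"
  by (simp_all add: adj_mat_def)

lemma A_index: "i < n \<Longrightarrow> j < n \<Longrightarrow> A $$ (i, j) = (if (i, j) \<in> parcs G then 1 else 0)"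
  by (simp add: adj_mat_def)

lemma A_symmetric: "transpose_mat A = A"
  by (rule eq_matI) (auto simp: adj_mat_def dest: arcD(4))

text \<open>Translates traces of products with \<open>A\<close> into sums over arcs, where each edge
  is counted in both directions.\<close>

lemma sum_A_eq_sum_arcs:
  "(\<Sum>i<n. \<Sum>j<n. A $$ (i, j) * f i j) = (\<Sum>(i, j)\<in>parcs G. f i j)"
proof -
  have "(\<Sum>i<n. \<Sum>j<n. A $$ (i, j) * f i j)
      = (\<Sum>(i, j)\<in>{..<n} \<times> {..<n}. if (i, j) \<in> parcs G then f i j else 0)"
    by (auto simp: sum.cartesian_product A_index intro!: sum.cong)
  also have "\<dots> = (\<Sum>(i, j)\<in>parcs G. if (i, j) \<in> parcs G then f i j else 0)"
    by (rule sum.mono_neutral_right) (auto dest: arcD)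
  also have "\<dots> = (\<Sum>(i, j)\<in>parcs G. f i j)"
    by (auto intro!: sum.cong)
  finally show ?thesis .
qed

lemma PtP: "transpose_mat P * P = 1\<^sub>m d"
  using P orthonormal by (intro eq_matI) auto

lemma eigenspace_iff:
  assumes "v \<in> carrier_vec n"
  shows "A *\<^sub>v v = \<tau> \<cdot>\<^sub>v v \<longleftrightarrow> (\<exists>w\<in>carrier_vec d. v = P *\<^sub>v w)"
proof -
  interpret vec_space "TYPE(real)" n .
  have "v \<in> eigenspace A \<tau> \<longleftrightarrow> v \<in> col_space P" using col_space by simp
  then show ?thesis
    using assms P unfolding col_space_eq[OF P] eigenspace_def by (auto simp: adj_mat_def)
qed

lemma A_mult_P: "A * P = \<tau> \<cdot>\<^sub>m P"
proof (rule mat_col_eqI)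
  fix j assume "j < dim_col (\<tau> \<cdot>\<^sub>m P)"
  then have j: "j < d" using P by simp
  have "P *\<^sub>v unit_vec d j = col P j" using P j by auto
  then have "A *\<^sub>v col P j = \<tau> \<cdot>\<^sub>v col P j"
    using eigenspace_iff[of "col P j"] P j by (metis col_carrier_vec carrier_matD unit_vec_carrier)
  then show "col (A * P) j = col (\<tau> \<cdot>\<^sub>m P) j" using P j by (simp add: col_mult2[OF A P])
qed (use P in \<open>auto simp: adj_mat_def\<close>)

text \<open>An eigenvector is \<open>v = P w\<close>, and \<open>P^T P = I\<close> gives
  \<open>P P^T v = P w = v\<close>.\<close>

lemma K_mult_vec:
  assumes v: "v \<in> carrier_vec n" and "A *\<^sub>v v = \<tau> \<cdot>\<^sub>v v"
  shows "K *\<^sub>v v = v"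
proof -
  obtain w where w: "w \<in> carrier_vec d" "v = P *\<^sub>v w" using assms eigenspace_iff by blast
  have "transpose_mat P *\<^sub>v v = (transpose_mat P * P) *\<^sub>v w"
    using P w by (simp add: assoc_mult_mat_vec[of _ d n _ d])
  then have "transpose_mat P *\<^sub>v v = w" using w by (simp add: PtP)
  then show ?thesis using P v w by (simp add: assoc_mult_mat_vec[of _ n d _ n])
qed

lemma K_symmetric: "transpose_mat K = K"
  using P by (simp add: transpose_mult[of _ n d _ n])

text \<open>The eigenvalue \<open>\<tau>\<close> has a nonzero eigenvector in the range of
  \<open>P\<close>; neither ambient dimension 0 nor a matrix without columns leaves room for
  one.\<close>

lemma d_pos: "d > 0" and n_pos: "n > 0"
proof -
  obtain v where v: "v \<in> carrier_vec n" "v \<noteq> 0\<^sub>v n" "A *\<^sub>v v = \<tau> \<cdot>\<^sub>v v"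
    using least unfolding is_least_eigenvalue_def eigenvalue_def eigenvector_def
    by (auto simp: adj_mat_def)
  show "n > 0" using v by (auto intro: gr0I)
  obtain w where w: "w \<in> carrier_vec d" "v = P *\<^sub>v w" using v eigenspace_iff by blast
  show "d > 0"
  proof (rule gr0I)
    assume "d = 0"
    then have "v = 0\<^sub>v n" using w P by (auto simp: scalar_prod_def)
    with v(2) show False by simp
  qed
qed

lemma psd: "pos_semidef (A - \<tau> \<cdot>\<^sub>m 1\<^sub>m n)"
  using A A_symmetric least by (rule least_eigenvalue_pos_semidef)

section \<open>Matrices constant on the diagonal and on the arcs\<close>

definition arc_values :: "real mat \<Rightarrow> real \<Rightarrow> real \<Rightarrow> bool" where
  "arc_values M a b \<longleftrightarrow>
    (\<forall>i. i < n \<longrightarrow> M $$ (i, i) = a) \<and> (\<forall>i j. (i, j) \<in> parcs G \<longrightarrow> M $$ (i, j) = b)"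

text \<open>The condition of 1-walk-regularity for a single matrix, read entry by entry. Entries at
  distinct non-adjacent positions stay free, which makes the condition stable under linear
  combinations.\<close>

definition arc_constant :: "real mat \<Rightarrow> bool" where
  "arc_constant M \<longleftrightarrow> (\<exists>a b. arc_values M a b)"

lemma arc_valuesD:
  assumes "arc_values M a b"
  shows "i < n \<Longrightarrow> M $$ (i, i) = a" "(i, j) \<in> parcs G \<Longrightarrow> M $$ (i, j) = b"
  using assms by (auto simp: arc_values_def)

lemma arc_constant_pow_A: "arc_constant (A ^\<^sub>m k)"
proof -
  obtain a b where
    a: "(A ^\<^sub>m k) \<odot> 1\<^sub>m n = a \<cdot>\<^sub>m 1\<^sub>m n" and b: "(A ^\<^sub>m k) \<odot> A = b \<cdot>\<^sub>m A"
    using regular unfolding one_walk_regular_def by blast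
  have dims: "dim_row (A ^\<^sub>m k) = n" "dim_col (A ^\<^sub>m k) = n"
    using pow_carrier_mat[OF A, of k] by auto
  have "(A ^\<^sub>m k) $$ (i, i) = a" if "i < n" for i
    using arg_cong[OF a, of "\<lambda>M. M $$ (i, i)"] that dims by (simp add: entrywise_prod_def)
  moreover have "(A ^\<^sub>m k) $$ (i, j) = b" if "(i, j) \<in> parcs G" for i j
    using arg_cong[OF b, of "\<lambda>M. M $$ (i, j)"] that arcD[OF that] dims
    by (simp add: entrywise_prod_def adj_mat_def)
  ultimately show ?thesis unfolding arc_constant_def arc_values_def by blast
qed

lemma arc_constant_lincomb:
  assumes "finite I" "\<And>k. k \<in> I \<Longrightarrow> arc_constant (M k)"
  shows "arc_constant (mat_lincomb n I h M)"
proof -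
  obtain a b where ab: "\<And>k. k \<in> I \<Longrightarrow> arc_values (M k) (a k) (b k)"
    using assms(2) unfolding arc_constant_def by metis
  have "mat_lincomb n I h M $$ (i, i) = (\<Sum>k\<in>I. h k * a k)" if "i < n" for i
    using that arc_valuesD(1)[OF ab] by (simp add: mat_lincomb_def)
  moreover have "mat_lincomb n I h M $$ (i, j) = (\<Sum>k\<in>I. h k * b k)" if "(i, j) \<in> parcs G" for i j
    using that arc_valuesD(2)[OF ab] arcD[OF that] by (simp add: mat_lincomb_def)
  ultimately show ?thesis unfolding arc_constant_def arc_values_def by blast
qed

lemma arc_constant_diff:
  assumes "M \<in> carrier_mat n n" "N \<in> carrier_mat n n" "arc_constant M" "arc_constant N"
  shows "arc_constant (M - c \<cdot>\<^sub>m N)"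
proof -
  obtain a b a' b' where ab: "arc_values M a b" "arc_values N a' b'"
    using assms(3,4) unfolding arc_constant_def by blast
  note ab = arc_valuesD[OF ab(1)] arc_valuesD[OF ab(2)]
  have "(M - c \<cdot>\<^sub>m N) $$ (i, i) = a - c * a'" if "i < n" for i
    using that ab assms(1,2) by simp
  moreover have "(M - c \<cdot>\<^sub>m N) $$ (i, j) = b - c * b'" if "(i, j) \<in> parcs G" for i j
    using that ab assms(1,2) arcD[OF that] by simp
  ultimately show ?thesis unfolding arc_constant_def arc_values_def by blast
qed

text \<open>The factor \<open>A^m\<close> generalizes the induction: with
  \<open>B = A - \<tau> I\<close>, one has
  \<open>B^(k+1) A^m = B^k A^(m+1) - \<tau> B^k A^m\<close>. This replaces a binomial expansion of
  \<open>B^k\<close>.\<close>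

lemma arc_constant_pow_shift_mult: "arc_constant ((A - \<tau> \<cdot>\<^sub>m 1\<^sub>m n) ^\<^sub>m k * A ^\<^sub>m m)"
proof (induction k arbitrary: m)
  case 0
  have "(A - \<tau> \<cdot>\<^sub>m 1\<^sub>m n) ^\<^sub>m 0 * A ^\<^sub>m m = A ^\<^sub>m m"
    using left_mult_one_mat[OF pow_carrier_mat[OF A]] by simp
  then show ?case using arc_constant_pow_A by simp
next
  case (Suc k)
  let ?B = "A - \<tau> \<cdot>\<^sub>m 1\<^sub>m n"
  have B: "?B \<in> carrier_mat n n" by (simp add: minus_carrier_mat)
  note carr = pow_carrier_mat[OF A, of m] pow_carrier_mat[OF B, of k] pow_carrier_mat[OF A, of "Suc m"]
  have "?B * A ^\<^sub>m m = A ^\<^sub>m Suc m - \<tau> \<cdot>\<^sub>m A ^\<^sub>m m"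
    unfolding pow_mat_Suc_left[OF A]
    using minus_mult_distrib_mat[of A n n "\<tau> \<cdot>\<^sub>m 1\<^sub>m n" "A ^\<^sub>m m" n] carr
    by (simp add: mult_smult_assoc_mat[of _ n n _ n] left_mult_one_mat[OF carr(1)])
  then have "?B ^\<^sub>m Suc k * A ^\<^sub>m m = ?B ^\<^sub>m k * (A ^\<^sub>m Suc m - \<tau> \<cdot>\<^sub>m A ^\<^sub>m m)"
    using carr B by (simp add: assoc_mult_mat[of _ n n _ n _ n])
  also have "\<dots> = ?B ^\<^sub>m k * A ^\<^sub>m Suc m - \<tau> \<cdot>\<^sub>m (?B ^\<^sub>m k * A ^\<^sub>m m)"
    using mult_minus_distrib_mat[OF carr(2,3), of "\<tau> \<cdot>\<^sub>m A ^\<^sub>m m"] carr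
    by (simp only: smult_carrier_mat mult_smult_distrib[OF carr(2,1)])
  finally show ?case
    using Suc.IH[of m] Suc.IH[of "Suc m"] carr
    by (metis arc_constant_diff mult_carrier_mat)
qed

text \<open>Let \<open>F\<close> be the linear combination of powers of \<open>A - \<tau> I\<close>
  that projects onto its kernel. The columns of \<open>K\<close> and of \<open>F\<close> lie in the
  eigenspace, which both matrices fix, so \<open>F K = K\<close> and \<open>K F = F\<close>.
  Transposing one equation gives \<open>K = F\<close> by symmetry, and \<open>F\<close> inherits the
  property from the powers.\<close>

lemma arc_constant_K: "arc_constant K"
proof -
  let ?B = "A - \<tau> \<cdot>\<^sub>m 1\<^sub>m n"
  have B: "?B \<in> carrier_mat n n" by (simp add: minus_carrier_mat)
  have Bsym: "transpose_mat ?B = ?B" using A A_symmetric by (rule symmetric_minus_smult_one)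
  obtain F I h where F: "F = mat_lincomb n I h (\<lambda>k. ?B ^\<^sub>m k)" "finite I"
    and BF: "\<forall>v \<in> carrier_vec n. ?B *\<^sub>v (F *\<^sub>v v) = 0\<^sub>v n"
    and Fv: "\<forall>v \<in> carrier_vec n. ?B *\<^sub>v v = 0\<^sub>v n \<longrightarrow> F *\<^sub>v v = v"
    using kernel_projection_in_powers[OF B Bsym] by blast
  have Fc: "F \<in> carrier_mat n n" by (simp add: F)
  have pow_sym: "(?B ^\<^sub>m k) $$ (j, i) = (?B ^\<^sub>m k) $$ (i, j)" if "i < n" "j < n" for i j k
    using transpose_pow_mat[OF B Bsym, of k] pow_carrier_mat[OF B, of k] that
    by (metis index_transpose_mat(1) carrier_matD)
  have Fsym: "transpose_mat F = F"
    unfolding F by (rule eq_matI) (auto simp: mat_lincomb_def pow_sym simp del: pow_mat.simps)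
  have "F * K = K"
  proof (rule mat_col_eqI)
    fix j assume "j < dim_col K"
    then have j: "j < n" using P by simp
    have col: "col K j = P *\<^sub>v col (transpose_mat P) j"
      by (rule col_mult2[OF P _ j]) (use P in simp)
    then have "A *\<^sub>v col K j = \<tau> \<cdot>\<^sub>v col K j"
      using eigenspace_iff[of "col K j"] j P K
      by (metis carrier_matD(2) col_dim carrier_vecI carrier_matD(1) index_transpose_mat(2))
    then have "F *\<^sub>v col K j = col K j"
      using Fv kernel_minus_smult_one_iff[OF A] j K
      by (metis carrier_matD(1) carrier_vecI col_dim)
    then show "col (F * K) j = col K j" using j by (simp add: col_mult2[OF Fc K])
  qed (use Fc P in auto)
  moreover have "K * F = F"
  proof (rule mat_col_eqI)
    fix j assume "j < dim_col F"
    then have j: "j < n" using Fc by auto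
    have u: "col F j = F *\<^sub>v unit_vec n j" using Fc j by auto
    have c: "col F j \<in> carrier_vec n" using Fc by (metis carrier_matD(1) carrier_vecI col_dim)
    have "A *\<^sub>v col F j = \<tau> \<cdot>\<^sub>v col F j"
      using bspec[OF BF unit_vec_carrier, of j] kernel_minus_smult_one_iff[OF A c] u by simp
    then show "col (K * F) j = col F j"
      using K_mult_vec[OF c] j by (simp add: col_mult2[OF K Fc])
  qed (use Fc P in auto)
  ultimately have "K = F"
    using transpose_mult[OF K Fc] K_symmetric Fsym by metis
  moreover have "arc_constant (?B ^\<^sub>m k)" for k
    using arc_constant_pow_shift_mult[of k 0] right_mult_one_mat[OF pow_carrier_mat[OF B, of k]] A
    by (simp add: adj_mat_def)
  then have "arc_constant F" unfolding F(1) by (intro arc_constant_lincomb[OF F(2)])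
  ultimately show ?thesis by simp
qed

text \<open>The sum of all squared entries of \<open>P\<close>, taken by rows on the left, is taken
  by columns instead; each column is a unit vector.\<close>

lemma trace_K: "(\<Sum>i<n. K $$ (i, i)) = d"
proof -
  have "(\<Sum>i<n. K $$ (i, i)) = (\<Sum>i<n. \<Sum>l<d. P $$ (i, l) * P $$ (i, l))"
    using P by (simp add: scalar_prod_def atLeast0LessThan)
  also have "\<dots> = (\<Sum>l<d. col P l \<bullet> col P l)"
    using P by (subst sum.swap) (simp add: scalar_prod_def atLeast0LessThan)
  also have "\<dots> = d" by (simp add: orthonormal)
  finally show ?thesis .
qed

lemma K_diag: "i < n \<Longrightarrow> K $$ (i, i) = d / n"
proof -
  obtain a where a: "\<And>i. i < n \<Longrightarrow> K $$ (i, i) = a"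
    using arc_constant_K unfolding arc_constant_def by (blast dest: arc_valuesD(1))
  have "n * a = d" using trace_K by (simp add: a del: index_mult_mat)
  then have "a = d / n" using n_pos by (simp add: field_simps)
  then show "i < n \<Longrightarrow> K $$ (i, i) = d / n" using a by simp
qed

text \<open>The arc sum is the trace of \<open>A K\<close>, and \<open>A K = \<tau> K\<close> has
  trace \<open>\<tau> d\<close>.\<close>

lemma sum_arcs_K: "(\<Sum>(i, j)\<in>parcs G. K $$ (i, j)) = \<tau> * d"
proof -
  have AK: "A * K = \<tau> \<cdot>\<^sub>m K"
    using assoc_mult_mat[OF A P, of "transpose_mat P" n] P
    by (simp add: A_mult_P mult_smult_assoc_mat[of _ n d _ n])
  have Ksym: "K $$ (i, j) = K $$ (j, i)" if "i < n" "j < n" for i j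
    using K_symmetric that K by (metis index_transpose_mat(1) carrier_matD)
  have "(\<Sum>i<n. \<Sum>j<n. A $$ (i, j) * K $$ (i, j)) = (\<Sum>i<n. \<Sum>j<n. A $$ (i, j) * K $$ (j, i))"
    by (intro sum.cong refl) (simp add: Ksym del: index_mult_mat)
  also have "\<dots> = (\<Sum>i<n. (A * K) $$ (i, i))"
    by (rule sum_diag_mult[OF A K, symmetric])
  also have "\<dots> = (\<Sum>i<n. \<tau> * K $$ (i, i))"
    unfolding AK using P by (intro sum.cong refl, subst index_smult_mat(1)) (auto simp del: index_mult_mat(1))
  also have "\<dots> = \<tau> * d" using trace_K by (simp add: sum_distrib_left[symmetric] del: index_mult_mat)
  finally show ?thesis by (simp only: sum_A_eq_sum_arcs)
qed

lemma K_arc: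
  assumes "(i, j) \<in> parcs G"
  shows "K $$ (i, j) = \<tau> * d / card (parcs G)"
proof -
  obtain b where b: "\<And>i j. (i, j) \<in> parcs G \<Longrightarrow> K $$ (i, j) = b"
    using arc_constant_K unfolding arc_constant_def by (blast dest: arc_valuesD(2))
  have "(\<Sum>(i, j)\<in>parcs G. K $$ (i, j)) = (\<Sum>(i, j)\<in>parcs G. b)"
    by (rule sum.cong) (auto simp: b simp del: index_mult_mat)
  then have "card (parcs G) * b = \<tau> * d" using sum_arcs_K by (simp add: case_prod_unfold)
  moreover have "card (parcs G) > 0" using assms finite_arcs by (auto simp: card_gt_0_iff)
  ultimately have "b = \<tau> * d / card (parcs G)" by (simp add: field_simps)
  then show ?thesis using b[OF assms] by simp
qed

section \<open>The trace inequality for Gram matrices of unit vectors\<close>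

context
  fixes q :: "nat \<Rightarrow> real vec" and m :: nat
  assumes q: "\<forall>i<n. q i \<in> carrier_vec m"
    and unit: "\<forall>i<n. q i \<bullet> q i = 1"
begin

text \<open>Both sides equal the trace of the Gram matrix times \<open>A - \<tau> I\<close>. The
  term \<open>\<tau> n\<close> comes from the unit diagonal of the Gram matrix.\<close>

lemma sum_arcs_gram_eq:
  fixes Q defines "Q \<equiv> mat n m (\<lambda>(i, l). q i $ l)"
  shows "(\<Sum>(i, j)\<in>parcs G. q i \<bullet> q j) - \<tau> * n
    = (\<Sum>l<m. col Q l \<bullet> ((A - \<tau> \<cdot>\<^sub>m 1\<^sub>m n) *\<^sub>v col Q l))"
proof -
  have Q: "Q \<in> carrier_mat n m" by (simp add: Q_def)
  have B: "A - \<tau> \<cdot>\<^sub>m 1\<^sub>m n \<in> carrier_mat n n" by (simp add: minus_carrier_mat)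
  have gram: "gram_mat n q = Q * transpose_mat Q"
    unfolding Q_def using q by (rule gram_mat_eq)
  have "(\<Sum>l<m. col Q l \<bullet> ((A - \<tau> \<cdot>\<^sub>m 1\<^sub>m n) *\<^sub>v col Q l))
      = (\<Sum>i<n. \<Sum>j<n. (A - \<tau> \<cdot>\<^sub>m 1\<^sub>m n) $$ (i, j) * (q i \<bullet> q j))"
    unfolding sum_form_cols[OF B Q, symmetric] gram[symmetric]
    by (intro sum.cong refl) (simp add: gram_mat_def)
  also have "\<dots> = (\<Sum>i<n. \<Sum>j<n. A $$ (i, j) * (q i \<bullet> q j) - (if i = j then \<tau> else 0))"
    by (intro sum.cong refl) (auto simp: unit algebra_simps)
  also have "\<dots> = (\<Sum>i<n. \<Sum>j<n. A $$ (i, j) * (q i \<bullet> q j)) - \<tau> * n"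
    by (simp add: sum_subtractf)
  finally show ?thesis by (simp add: sum_A_eq_sum_arcs)
qed

lemma sum_arcs_gram_ge: "\<tau> * n \<le> (\<Sum>(i, j)\<in>parcs G. q i \<bullet> q j)"
proof -
  have "0 \<le> (\<Sum>l<m. col (mat n m (\<lambda>(i, l). q i $ l)) l
      \<bullet> ((A - \<tau> \<cdot>\<^sub>m 1\<^sub>m n) *\<^sub>v col (mat n m (\<lambda>(i, l). q i $ l)) l))"
    using psd unfolding pos_semidef_def by (intro sum_nonneg) auto
  then show ?thesis unfolding sum_arcs_gram_eq[symmetric] by simp
qed

text \<open>In the equality case a sum of nonnegative forms vanishes, so every column of the
  coordinate matrix \<open>Q\<close> lies in the kernel of \<open>A - \<tau> I\<close>. Hence
  \<open>K Q = Q\<close>, and \<open>K\<close> is absorbed on both sides of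
  \<open>Q Q^T\<close>.\<close>

lemma gram_mat_fixed:
  assumes "(\<Sum>(i, j)\<in>parcs G. q i \<bullet> q j) = \<tau> * n"
  shows "K * gram_mat n q * K = gram_mat n q"
proof -
  let ?B = "A - \<tau> \<cdot>\<^sub>m 1\<^sub>m n"
  define Q where "Q = mat n m (\<lambda>(i, l). q i $ l)"
  have Q: "Q \<in> carrier_mat n m" by (simp add: Q_def)
  have B: "?B \<in> carrier_mat n n" by (simp add: minus_carrier_mat)
  have Bsym: "transpose_mat ?B = ?B" using A A_symmetric by (rule symmetric_minus_smult_one)
  have c: "col Q l \<in> carrier_vec n" for l using Q by (metis carrier_matD(1) carrier_vecI col_dim)
  have "(\<Sum>l<m. col Q l \<bullet> (?B *\<^sub>v col Q l)) = 0"
    using assms sum_arcs_gram_eq unfolding Q_def by simp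
  then have "col Q l \<bullet> (?B *\<^sub>v col Q l) = 0" if "l < m" for l
    using that psd c B unfolding pos_semidef_def
    by (subst (asm) sum_nonneg_eq_0_iff) auto
  then have "?B *\<^sub>v col Q l = 0\<^sub>v n" if "l < m" for l
    using pos_semidef_form_eq_0D[OF B Bsym psd c] that by blast
  then have "K *\<^sub>v col Q l = col Q l" if "l < m" for l
    using that K_mult_vec[OF c] kernel_minus_smult_one_iff[OF A c] by blast
  then have KQ: "K * Q = Q"
    using Q P by (intro mat_col_eqI) (auto simp: col_mult2[OF K Q] simp del: assoc_mult_mat assoc_mult_mat_vec)
  have gram: "gram_mat n q = Q * transpose_mat Q"
    unfolding Q_def using q by (rule gram_mat_eq)
  have "transpose_mat Q * K = transpose_mat (K * Q)"
    using transpose_mult[OF K Q] K_symmetric by simp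
  then have QK: "transpose_mat Q * K = transpose_mat Q" by (simp only: KQ)
  have Qt: "transpose_mat Q \<in> carrier_mat m n" using Q by simp
  have "K * (Q * transpose_mat Q) = Q * transpose_mat Q"
    using assoc_mult_mat[OF K Q Qt] KQ by simp
  moreover have "(Q * transpose_mat Q) * K = Q * transpose_mat Q"
    using assoc_mult_mat[OF Q Qt K] QK by simp
  ultimately show ?thesis unfolding gram by simp
qed

lemma abs_gram_le_1:
  assumes "i < n" "j < n"
  shows "\<bar>q i \<bullet> q j\<bar> \<le> 1"
proof -
  \<comment> \<open>The usual Cauchy-Schwarz inequality is the case of the identity matrix.\<close>
  have "pos_semidef (1\<^sub>m m)"
    unfolding pos_semidef_def by (simp add: scalar_prod_def sum_nonneg)
  from pos_semidef_Cauchy_Schwarz[OF one_carrier_mat transpose_one this q[rule_format, OF assms(2)] q[rule_format, OF assms(1)]]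
  have "(q i \<bullet> q j)\<^sup>2 \<le> 1\<^sup>2" using assms q unit by simp
  then show ?thesis by (simp only: abs_le_square_iff[symmetric] abs_one)
qed

end

section \<open>The vector chromatic number and optimal colorings\<close>

abbreviation "arc_value \<equiv> \<tau> * n / card (parcs G)"

text \<open>The diagonal of \<open>A\<close> is 0, so the form of \<open>A - \<tau> I\<close> at a
  unit vector \<open>e_i\<close> is \<open>- \<tau>\<close>, whence \<open>\<tau> \<le> 0\<close>.
  If \<open>\<tau> = 0\<close>, then \<open>A e_i = 0\<close>, against the entry 1 of an arc at
  \<open>i\<close>.\<close>

lemma arc_value_neg:
  assumes "parcs G \<noteq> {}"
  shows "arc_value < 0"
proof -
  obtain i j where ij: "(i, j) \<in> parcs G" using assms by auto
  let ?u = "unit_vec n i :: real vec"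
  have B: "A - \<tau> \<cdot>\<^sub>m 1\<^sub>m n \<in> carrier_mat n n" by (simp add: minus_carrier_mat)
  have Bsym: "transpose_mat (A - \<tau> \<cdot>\<^sub>m 1\<^sub>m n) = A - \<tau> \<cdot>\<^sub>m 1\<^sub>m n"
    using A A_symmetric by (rule symmetric_minus_smult_one)
  have i: "i < n" "j < n" "i \<noteq> j" using arcD[OF ij] by auto
  have Aii: "A $$ (i, i) = 0" using i arcD(3) A_index by auto
  have Au: "A *\<^sub>v ?u = col A i" using i by (intro eq_vecI) auto
  then have form: "?u \<bullet> ((A - \<tau> \<cdot>\<^sub>m 1\<^sub>m n) *\<^sub>v ?u) = - \<tau>"
    using i Aii by (simp add: form_minus_smult_one[OF A])
  moreover have "0 \<le> ?u \<bullet> ((A - \<tau> \<cdot>\<^sub>m 1\<^sub>m n) *\<^sub>v ?u)"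
    using psd unfolding pos_semidef_def by (auto simp del: scalar_prod_left_unit)
  ultimately have "\<tau> \<le> 0" by simp
  moreover have "\<tau> \<noteq> 0"
  proof
    assume "\<tau> = 0"
    then have "A *\<^sub>v ?u = \<tau> \<cdot>\<^sub>v ?u"
      using pos_semidef_form_eq_0D[OF B Bsym psd, of ?u] form kernel_minus_smult_one_iff[OF A] by simp
    then have "col A i $ j = (\<tau> \<cdot>\<^sub>v ?u) $ j" using Au by simp
    then show False using i \<open>\<tau> = 0\<close> ij arcD(4)[OF ij] by (simp add: A_index)
  qed
  moreover have "card (parcs G) > 0" using assms finite_arcs by (simp add: card_gt_0_iff)
  ultimately show ?thesis using n_pos by (simp add: divide_neg_pos mult_neg_pos)
qed

lemma arc_value_sum: "card (parcs G) * arc_value = \<tau> * n"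
proof (cases "parcs G = {}")
  case True
  \<comment> \<open>The empty arc sum of \<open>K\<close> equals \<open>\<tau> d\<close> with
    \<open>d > 0\<close>.\<close>
  then have "\<tau> = 0" using sum_arcs_K d_pos by simp
  then show ?thesis by simp
next
  case False
  then show ?thesis using finite_arcs by (simp add: card_eq_0_iff)
qed

text \<open>The framework scaled to unit length: \<open>p_i\<close> has squared length
  \<open>d / n\<close>, and the Gram matrix becomes \<open>(n / d) K\<close>.\<close>

definition canonical_coloring :: "nat \<Rightarrow> real vec" where
  "canonical_coloring i = sqrt (n / d) \<cdot>\<^sub>v row P i"

lemma canonical_coloring:
  shows "\<forall>i<n. canonical_coloring i \<in> carrier_vec d"
    and "\<forall>i<n. canonical_coloring i \<bullet> canonical_coloring i = 1"
    and "\<forall>(i, j)\<in>parcs G. canonical_coloring i \<bullet> canonical_coloring j = arc_value"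
proof -
  have row: "row P i \<in> carrier_vec d" for i using P row_carrier[of P i] by simp
  have prod: "canonical_coloring i \<bullet> canonical_coloring j = n / d * K $$ (i, j)"
    if "i < n" "j < n" for i j
    using that P row by (simp add: canonical_coloring_def mult.assoc[symmetric])
  show "\<forall>i<n. canonical_coloring i \<in> carrier_vec d"
    using row by (simp add: canonical_coloring_def)
  show "\<forall>i<n. canonical_coloring i \<bullet> canonical_coloring i = 1"
    using prod K_diag n_pos d_pos by simp
  show "\<forall>(i, j)\<in>parcs G. canonical_coloring i \<bullet> canonical_coloring j = arc_value"
  proof clarify
    fix i j assume ij: "(i, j) \<in> parcs G"
    show "canonical_coloring i \<bullet> canonical_coloring j = arc_value"
      using prod[OF arcD(1,2)[OF ij]] K_arc[OF ij] n_pos d_pos by simp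
  qed
qed

text \<open>The parameter \<open>t\<close> solves \<open>- 1 / (t - 1) = arc_value\<close>. That
  \<open>t \<ge> 2\<close> follows from \<open>-1 \<le> arc_value < 0\<close>, the lower bound being
  Cauchy-Schwarz for the ends of an arc.\<close>

lemma vector_t_coloring_arc_value:
  assumes arcs: "parcs G \<noteq> {}"
    and q: "\<forall>i<n. q i \<in> carrier_vec m" and unit: "\<forall>i<n. q i \<bullet> q i = 1"
    and arc: "\<forall>(i, j)\<in>parcs G. q i \<bullet> q j = arc_value"
  shows "vector_t_coloring n G (1 - 1 / arc_value) q"
proof -
  obtain i j where ij: "(i, j) \<in> parcs G" using arcs by auto
  have "\<bar>arc_value\<bar> \<le> 1" using abs_gram_le_1[OF q unit arcD(1,2)[OF ij]] arc ij by auto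
  moreover have "2 \<le> 1 - 1 / s" if "s < 0" "\<bar>s\<bar> \<le> 1" for s :: real
    using that by (simp add: neg_divide_le_eq)
  ultimately have "2 \<le> 1 - 1 / arc_value"
    using arc_value_neg[OF arcs] by blast
  then show ?thesis unfolding vector_t_coloring_def using q unit arc by auto
qed

lemma vector_t_coloring_arcs_le:
  assumes q: "vector_t_coloring n G t q"
  shows "\<tau> * n \<le> (\<Sum>(i, j)\<in>parcs G. q i \<bullet> q j)"
    and "(i, j) \<in> parcs G \<Longrightarrow> q i \<bullet> q j \<le> - 1 / (t - 1)"
  using q sum_arcs_gram_ge[of q] unfolding vector_t_coloring_def by auto

text \<open>The canonical coloring attains the value. For any other \<open>t\<close>, averaging over
  the arcs puts \<open>arc_value\<close> below the mean inner product, which is at most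
  \<open>- 1 / (t - 1)\<close>.\<close>

lemma vector_chromatic_number_eq:
  assumes arcs: "parcs G \<noteq> {}"
  shows "vector_chromatic_number n G = 1 - 1 / arc_value"
  unfolding vector_chromatic_number_def
proof (rule Least_equality)
  show "\<exists>q. vector_t_coloring n G (1 - 1 / arc_value) q"
    using vector_t_coloring_arc_value[OF arcs canonical_coloring] by blast
next
  fix t assume "\<exists>q. vector_t_coloring n G t q"
  then obtain q where q: "vector_t_coloring n G t q" by blast
  then have t: "t \<ge> 2" by (simp add: vector_t_coloring_def)
  have "(\<Sum>(i, j)\<in>parcs G. q i \<bullet> q j) \<le> (\<Sum>(i, j)\<in>parcs G. - 1 / (t - 1))"
    by (rule sum_mono) (use vector_t_coloring_arcs_le(2)[OF q] in auto)
  then have "\<tau> * n \<le> (\<Sum>(i, j)\<in>parcs G. - 1 / (t - 1))"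
    using vector_t_coloring_arcs_le(1)[OF q] by linarith
  then have "card (parcs G) * arc_value \<le> card (parcs G) * (- 1 / (t - 1))"
    unfolding arc_value_sum by (simp add: case_prod_unfold)
  moreover have "card (parcs G) > 0" using arcs finite_arcs by (simp add: card_gt_0_iff)
  ultimately have "arc_value \<le> - 1 / (t - 1)" by (simp only: mult_le_cancel_left_pos of_nat_0_less_iff)
  moreover have "1 - 1 / s \<le> t" if "s < 0" "s \<le> - 1 / (t - 1)" for s
  proof -
    have "(t - 1) * s \<le> - 1" using that t by (simp only: pos_le_divide_eq mult.commute)
    then have "- 1 / s \<le> t - 1" using that by (simp only: neg_divide_le_eq)
    then show ?thesis by simp
  qed
  ultimately show "1 - 1 / arc_value \<le> t"
    using arc_value_neg[OF arcs] by blast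
qed

text \<open>Optimality bounds every arc product above by \<open>arc_value\<close>, while the trace
  inequality bounds their sum below by the number of arcs times \<open>arc_value\<close>; so all the
  bounds are equalities.\<close>

lemma optimal_vector_coloring_iff_arc_value:
  assumes "vector_coloring n G q"
  shows "optimal_vector_coloring n G q \<longleftrightarrow> (\<forall>(i, j)\<in>parcs G. q i \<bullet> q j = arc_value)"
proof (cases "parcs G = {}")
  case True
  \<comment> \<open>Without arcs only the requirement \<open>t \<ge> 2\<close> restricts
    \<open>t\<close>, so the chromatic number is 2 and both sides of the equivalence hold.\<close>
  have two: "vector_t_coloring n G 2 q"
    using assms True unfolding vector_coloring_def vector_t_coloring_def by simp
  have "vector_chromatic_number n G = 2"
    unfolding vector_chromatic_number_def
    by (rule Least_equality) (use two in \<open>blast, auto simp: vector_t_coloring_def\<close>)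
  then show ?thesis using two True by (simp add: optimal_vector_coloring_def)
next
  case False
  obtain m where q: "\<forall>i<n. q i \<in> carrier_vec m" and unit: "\<forall>i<n. q i \<bullet> q i = 1"
    using assms unfolding vector_coloring_def vector_t_coloring_def by auto
  show ?thesis
  proof
    assume "optimal_vector_coloring n G q"
    then have col: "vector_t_coloring n G (1 - 1 / arc_value) q"
      by (simp only: optimal_vector_coloring_def vector_chromatic_number_eq[OF False])
    have le: "q i \<bullet> q j \<le> arc_value" if "(i, j) \<in> parcs G" for i j
      using vector_t_coloring_arcs_le(2)[OF col that] by simp
    have "(\<Sum>(i, j)\<in>parcs G. arc_value - q i \<bullet> q j)
        = card (parcs G) * arc_value - (\<Sum>(i, j)\<in>parcs G. q i \<bullet> q j)"
      by (simp add: case_prod_unfold sum_subtractf)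
    also have "\<dots> \<le> 0" unfolding arc_value_sum using vector_t_coloring_arcs_le(1)[OF col] by simp
    finally have "(\<Sum>(i, j)\<in>parcs G. arc_value - q i \<bullet> q j) = 0"
      using le by (intro antisym sum_nonneg) auto
    then have "\<forall>e\<in>parcs G. (case e of (i, j) \<Rightarrow> arc_value - q i \<bullet> q j) = 0"
      using le by (subst (asm) sum_nonneg_eq_0_iff) (auto simp: finite_arcs)
    then show "\<forall>(i, j)\<in>parcs G. q i \<bullet> q j = arc_value" by auto
  next
    assume "\<forall>(i, j)\<in>parcs G. q i \<bullet> q j = arc_value"
    then have "vector_t_coloring n G (1 - 1 / arc_value) q"
      by (rule vector_t_coloring_arc_value[OF False q unit])
    then show "optimal_vector_coloring n G q"
      by (simp only: optimal_vector_coloring_def vector_chromatic_number_eq[OF False])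
  qed
qed

section \<open>The Gram matrix description of optimal colorings\<close>

lemma PRPt_index:
  assumes "R \<in> carrier_mat d d" "i < n" "j < n"
  shows "(P * R * transpose_mat P) $$ (i, j) = row P i \<bullet> (R *\<^sub>v row P j)"
proof -
  have Pt: "transpose_mat P \<in> carrier_mat d n" using P by simp
  have "P * R * transpose_mat P = P * (R * transpose_mat P)"
    using P assms Pt by (simp add: assoc_mult_mat[of _ n d _ d _ n])
  also have "\<dots> $$ (i, j) = row P i \<bullet> col (R * transpose_mat P) j"
    using P assms by simp
  also have "col (R * transpose_mat P) j = R *\<^sub>v row P j"
    using col_mult2[OF assms(1) Pt assms(3)] P assms(3) by simp
  finally show ?thesis .
qed

text \<open>If \<open>R\<close> is given, \<open>P R P^T\<close> vanishes on arcs, so the Gram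
  matrix agrees there with \<open>(n / d) K\<close>. Conversely, constant arc products are the
  equality case of the trace inequality, so the Gram matrix lives on the eigenspace and can be
  expressed through \<open>P\<close>.\<close>

lemma arc_value_iff_gram_mat:
  assumes q: "\<forall>i<n. q i \<in> carrier_vec m" and unit: "\<forall>i<n. q i \<bullet> q i = 1"
  shows "(\<forall>(i, j)\<in>parcs G. q i \<bullet> q j = arc_value) \<longleftrightarrow>
    (\<exists>R \<in> carrier_mat d d. transpose_mat R = R \<and>
       (\<forall>i<n. \<forall>j<n. i = j \<or> (i, j) \<in> parcs G \<longrightarrow> row P i \<bullet> (R *\<^sub>v row P j) = 0) \<and>
       gram_mat n q = (real n / real d) \<cdot>\<^sub>m (K + P * R * transpose_mat P))"
  (is "?L \<longleftrightarrow> ?R")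
proof
  have Pt: "transpose_mat P \<in> carrier_mat d n" using P by simp
  assume ?R
  then obtain R where R: "R \<in> carrier_mat d d"
    and zero: "\<And>i j. i < n \<Longrightarrow> j < n \<Longrightarrow> (i, j) \<in> parcs G \<Longrightarrow> row P i \<bullet> (R *\<^sub>v row P j) = 0"
    and gram: "gram_mat n q = (real n / real d) \<cdot>\<^sub>m (K + P * R * transpose_mat P)"
    by blast
  have PRPt: "P * R * transpose_mat P \<in> carrier_mat n n" using P R Pt by (metis mult_carrier_mat)
  show ?L
  proof (clarify)
    fix i j assume ij: "(i, j) \<in> parcs G"
    note lt = arcD(1,2)[OF ij]
    have "q i \<bullet> q j = gram_mat n q $$ (i, j)" using lt by (simp add: gram_mat_def)
    also have "\<dots> = n / d * (K $$ (i, j) + (P * R * transpose_mat P) $$ (i, j))"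
      unfolding gram using lt P by (simp del: index_mult_mat(1))
    also have "\<dots> = arc_value"
      using PRPt_index[OF R lt] zero[OF lt ij] K_arc[OF ij] d_pos by simp
    finally show "q i \<bullet> q j = arc_value" .
  qed
next
  have Pt: "transpose_mat P \<in> carrier_mat d n" using P by simp
  assume L: ?L
  have "(\<Sum>(i, j)\<in>parcs G. q i \<bullet> q j) = (\<Sum>(i, j)\<in>parcs G. arc_value)"
    using L by (intro sum.cong) auto
  then have "(\<Sum>(i, j)\<in>parcs G. q i \<bullet> q j) = \<tau> * n"
    using arc_value_sum by (simp add: case_prod_unfold)
  then have fixed: "K * gram_mat n q * K = gram_mat n q"
    by (rule gram_mat_fixed[OF q unit])
  define M where "M = gram_mat n q"
  have M: "M \<in> carrier_mat n n" by (simp add: M_def gram_mat_def)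
  have M_index: "M $$ (i, j) = q i \<bullet> q j" if "i < n" "j < n" for i j
    using that by (simp add: M_def gram_mat_def)
  have Msym: "transpose_mat M = M"
    by (rule eq_matI) (use q in \<open>auto simp: M_def gram_mat_def intro: comm_scalar_prod\<close>)
  \<comment> \<open>The Gram matrix in the coordinates of the eigenspace; nothing is lost, since
    \<open>P S P^T = K M K = M\<close>.\<close>
  define S where "S = transpose_mat P * M * P"
  have S: "S \<in> carrier_mat d d" unfolding S_def using P Pt M by (metis mult_carrier_mat)
  have Ssym: "transpose_mat S = S"
    unfolding S_def
    using P M Pt Msym
    by (simp add: transpose_mult[of _ d n _ d] transpose_mult[of _ n n _ d] assoc_mult_mat[of _ d n _ n _ d])
  have PSPt: "P * S * transpose_mat P = M"
  proof -
    have "P * S * transpose_mat P = K * M * K"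
      unfolding S_def using P M Pt
      by (simp add: assoc_mult_mat[of _ d n _ n _ d] assoc_mult_mat[of _ n d _ d _ n]
          assoc_mult_mat[of _ n d _ n _ n] assoc_mult_mat[of _ n d _ n _ d] assoc_mult_mat[of _ d n _ d _ n]
          assoc_mult_mat[of _ n n _ d _ n] assoc_mult_mat[of _ n n _ n _ n] assoc_mult_mat[of _ d n _ n _ n]
          mult_carrier_mat[of _ n d _ n] mult_carrier_mat[of _ d n _ d] mult_carrier_mat[of _ n n _ d])
    then show ?thesis using fixed by (simp add: M_def)
  qed
  \<comment> \<open>Solves \<open>S = (n / d) (I + R)\<close>, which becomes the required identity
    after multiplication by \<open>P\<close> and \<open>P^T\<close>.\<close>
  define R where "R = (d / n) \<cdot>\<^sub>m S - 1\<^sub>m d"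
  have R: "R \<in> carrier_mat d d" unfolding R_def using S by (simp add: minus_carrier_mat)
  have Rsym: "transpose_mat R = R"
  proof -
    have "transpose_mat ((d / n) \<cdot>\<^sub>m S) = (d / n) \<cdot>\<^sub>m transpose_mat S"
      by (rule eq_matI) auto
    then have "transpose_mat ((d / n) \<cdot>\<^sub>m S) = (d / n) \<cdot>\<^sub>m S"
      by (simp only: Ssym)
    then show ?thesis unfolding R_def using S by (simp add: transpose_minus[of _ d d])
  qed
  have form: "row P i \<bullet> (R *\<^sub>v row P j) = d / n * (q i \<bullet> q j) - K $$ (i, j)"
    if ij: "i < n" "j < n" for i j
  proof -
    have r: "row P i \<in> carrier_vec d" for i using P row_carrier[of P i] by simp
    have "R *\<^sub>v row P j = (d / n) \<cdot>\<^sub>v (S *\<^sub>v row P j) - row P j"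
    proof -
      have "((d / n) \<cdot>\<^sub>m S) *\<^sub>v row P j = (d / n) \<cdot>\<^sub>v (S *\<^sub>v row P j)"
        using S r[of j] by (rule smult_mat_mult_vec)
      then show ?thesis
        unfolding R_def using S r[of j] by (simp add: minus_mult_distrib_mat_vec[of _ d d])
    qed
    then have "row P i \<bullet> (R *\<^sub>v row P j) = d / n * (row P i \<bullet> (S *\<^sub>v row P j)) - row P i \<bullet> row P j"
      using S r[of i] r[of j] by (simp add: scalar_prod_minus_distrib[of _ d])
    also have "row P i \<bullet> (S *\<^sub>v row P j) = q i \<bullet> q j"
      using PRPt_index[OF S ij] M_index[OF ij] by (simp add: PSPt)
    also have "row P i \<bullet> row P j = K $$ (i, j)" using P ij by simp
    finally show ?thesis .
  qed
  have PRPt: "P * R * transpose_mat P \<in> carrier_mat n n" using P R Pt by (metis mult_carrier_mat)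
  show ?R
  proof (intro bexI[OF _ R] conjI allI impI)
    show "transpose_mat R = R" by (rule Rsym)
  next
    fix i j assume ij: "i < n" "j < n" "i = j \<or> (i, j) \<in> parcs G"
    show "row P i \<bullet> (R *\<^sub>v row P j) = 0"
    proof (cases "i = j")
      case True
      \<comment> \<open>On the diagonal the unit length contributes \<open>d / n\<close>, which
        cancels \<open>K_ii\<close>; on an arc \<open>(d / n) arc_value\<close> cancels
        \<open>K_ij\<close> likewise.\<close>
      then show ?thesis using form[OF ij(1,2)] unit K_diag[OF ij(2)] ij n_pos d_pos by simp
    next
      case False
      then have "(i, j) \<in> parcs G" using ij(3) by simp
      then show ?thesis using form[OF ij(1,2)] K_arc L n_pos by auto
    qed
  next
    show "gram_mat n q = (real n / real d) \<cdot>\<^sub>m (K + P * R * transpose_mat P)" (is "_ = ?N")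
    proof (rule eq_matI)
      fix i j assume "i < dim_row ?N" "j < dim_col ?N"
      then have ij: "i < n" "j < n" using P by auto
      have "?N $$ (i, j) = n / d * (K $$ (i, j) + (P * R * transpose_mat P) $$ (i, j))"
        using ij P by (simp del: index_mult_mat(1))
      also have "\<dots> = q i \<bullet> q j"
        using PRPt_index[OF R ij] form[OF ij] n_pos d_pos by (simp del: index_mult_mat)
      finally show "gram_mat n q $$ (i, j) = ?N $$ (i, j)" using ij by (simp add: gram_mat_def)
    qed (use P in \<open>auto simp: gram_mat_def\<close>)
  qed
qed

end

theorem theorem4p10:
  fixes n d :: nat
    and G :: "nat pair_pre_digraph"
    and P :: "real mat"
    and p q :: "nat \<Rightarrow> real vec"
  assumes "pair_graph G"
    and "pverts G = {0..<n}"
    and "one_walk_regular n G"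
    and "least_eigenvalue_framework_matrix n G d P"
    and "\<And>i. i < n \<Longrightarrow> p i = row P i"
    and "vector_coloring n G q"
  shows "optimal_vector_coloring n G q \<longleftrightarrow>
    (\<exists>R \<in> carrier_mat d d.
       transpose_mat R = R \<and>
       (\<forall>i<n. \<forall>j<n. i = j \<or> (i, j) \<in> parcs G \<longrightarrow> p i \<bullet> (R *\<^sub>v p j) = 0) \<and>
       gram_mat n q =
         (real n / real d) \<cdot>\<^sub>m (P * transpose_mat P + P * R * transpose_mat P))"
proof -
  obtain \<tau> where "least_eigenvalue_framework n d G P \<tau>"
    using assms(1-4) unfolding least_eigenvalue_framework_matrix_def least_eigenvalue_framework_def
    by auto
  then interpret least_eigenvalue_framework n d G P \<tau> .
  obtain m where "\<forall>i<n. q i \<in> carrier_vec m" "\<forall>i<n. q i \<bullet> q i = 1"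
    using assms(6) unfolding vector_coloring_def vector_t_coloring_def by auto
  note arc_value_iff_gram_mat[OF this]
  then show ?thesis
    unfolding optimal_vector_coloring_iff_arc_value[OF assms(6)] by (simp add: assms(5) cong: conj_cong imp_cong)
qed

end
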